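(* Let $n\ge 1$ and let $\mathbf m(k)$ be one of the two types of $n\times n$ matrices described in the context (Robin type with parameter $\alpha\in\mathbb R$, or mixed type with subset $S\subseteq\{1,\dots,n\}$). Let $\mathcal R(k_1,k_2)$ and $\mathcal B(k)$ be the Yang-Baxter map on $\mathbb{CP}^{n-1}\times\mathbb{CP}^{n-1}$ and the reflection map on $\mathbb{CP}^{n-1}$ defined in the context. Then, for all $k_1,k_2\in\mathbb C\setminus i\mathbb R$ with $k_1\notin\{k_2,\,k_2^*,\,-k_2,\,-k_2^*\}$, the following set-theoretical (parametric) reflection equation holds as an identity of maps on $\mathbb{CP}^{n-1}\times\mathbb{CP}^{n-1}$: $$\mathcal B_1(k_1)\,\mathcal R_{21}(-k_2^*,k_1)\,\mathcal B_2(k_2)\,\mathcal R_{12}(k_1,k_2)=\mathcal R_{21}(-k_2^*,-k_1^* )\,\mathcal B_2(k_2)\,\mathcal R_{12}(-k_1^*,k_2)\,\mathcal B_1(k_1).$$ Moreover, for every $k\in\mathbb C\setminus i\mathbb R$, the reflection map satisfies the involutive property $$\mathcal B(-k^* )\,\mathcal B(k)=\mathrm{Id}\quad\text{on }\mathbb{CP}^{n-1}.$$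
   Context: $^*$ denotes complex conjugation, $^\dagger$ the conjugate transpose, and $I_n$ the $n\times n$ identity matrix. Points of $\mathbb{CP}^{n-1}$ are represented by nonzero column vectors $\mathbf p\in\mathbb C^n$ up to nonzero scalar multiples. Products of maps denote composition, the rightmost map acting first. The map $\mathcal R(k_1,k_2):(\mathbf p_1,\mathbf p_2)\mapsto(\mathbf p_1',\mathbf p_2')$ on $\mathbb{CP}^{n-1}\times\mathbb{CP}^{n-1}$ is defined by $$\mathbf p_1'=\Big(I_n+\Big(\tfrac{k_1^*-k_2}{k_1^*-k_2^*}-1\Big)\tfrac{\mathbf p_2\mathbf p_2^\dagger}{\mathbf p_2^\dagger\mathbf p_2}\Big)\mathbf p_1,\qquad \mathbf p_2'=\Big(I_n+\Big(\tfrac{k_2-k_1^*}{k_2-k_1}-1\Big)\tfrac{\mathbf p_1\mathbf p_1^\dagger}{\mathbf p_1^\dagger\mathbf p_1}\Big)\mathbf p_2 .$$ $\mathcal R_{12}(a,b)=\mathcal R(a,b)$, and $\mathcal R_{21}(a,b)=P\,\mathcal R(a,b)\,P$ where $P(\mathbf p_1,\mathbf p_2)=(\mathbf p_2,\mathbf p_1)$. Thus in $\mathcal R_{21}(a,b)$ the parameter $a$ is attached to the second factor and $b$ to the first. The matrix $\mathbf m(k)$, $k\in\mathbb C\setminus i\mathbb R$, is either (Robin type) $\mathbf m(k)=\frac{h(k)}{|h(k)|}I_n$ with $h(k)=\frac{k-i\alpha}{k+i\alpha}$ for a fixed $\alpha\in\mathbb R$, or (mixed type) the constant matrix $\mathbf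 m(k)=\mathrm{diag}(\sigma_1,\dots,\sigma_n)$ with $\sigma_p=1$ for $p\in S$ and $\sigma_p=-1$ for $p\notin S$, for a fixed subset $S\subseteq\{1,\dots,n\}$. The reflection map, for $k\in\mathbb C\setminus i\mathbb R$, is $$\mathcal B(k):\mathbf p\mapsto\Big(I_n+\tfrac{k-k^*}{k+k^*}\,\tfrac{\mathbf p\,\mathbf p^\dagger}{\mathbf p^\dagger\mathbf p}\Big)\mathbf m(k)\,\mathbf p .$$ $\mathcal B_j(k)$, $j=1,2$, denotes the map of $\mathbb{CP}^{n-1}\times\mathbb{CP}^{n-1}$ acting as $\mathcal B(k)$ on the $j$-th factor and as the identity on the other. *)

theory Defs
  imports "HOL-Analysis.Analysis"
begin

text \<open>Complex projective space \<open>CP\<^sup>n\<^sup>-\<^sup>1\<close> with \<open>n = CARD('n)\<close>: nonzero vectors up to nonzero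
  complex scalars. The point with homogeneous coordinates \<open>p \<noteq> 0\<close> is \<^term>\<open>abs_cproj p\<close>.\<close>

definition cproj_rel :: "complex ^ 'n \<Rightarrow> complex ^ 'n \<Rightarrow> bool" where
  "cproj_rel p q \<longleftrightarrow> p \<noteq> 0 \<and> q \<noteq> 0 \<and> (\<exists>c. c \<noteq> 0 \<and> q = c *s p)"

lemma cproj_rel_part_equivp: "part_equivp (cproj_rel :: complex ^ 'n \<Rightarrow> complex ^ 'n \<Rightarrow> bool)"
proof (rule part_equivpI)
  have "cproj_rel (axis undefined 1 :: complex ^ 'n) (axis undefined 1)"
    unfolding cproj_rel_def by (intro conjI exI[of _ 1]) (auto simp: axis_eq_0_iff)
  then show "\<exists>p :: complex ^ 'n. cproj_rel p p" by blast
  show "symp (cproj_rel :: complex ^ 'n \<Rightarrow> _)"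
  proof (rule sympI)
    fix p q :: "complex ^ 'n"
    assume "cproj_rel p q"
    then obtain c where "p \<noteq> 0" "q \<noteq> 0" "c \<noteq> 0" "q = c *s p"
      unfolding cproj_rel_def by blast
    then show "cproj_rel q p"
      unfolding cproj_rel_def by (intro conjI exI[of _ "inverse c"]) auto
  qed
  show "transp (cproj_rel :: complex ^ 'n \<Rightarrow> _)"
  proof (rule transpI)
    fix p q r :: "complex ^ 'n"
    assume "cproj_rel p q" "cproj_rel q r"
    then obtain c d where "p \<noteq> 0" "r \<noteq> 0" "c \<noteq> 0" "d \<noteq> 0" "q = c *s p" "r = d *s q"
      unfolding cproj_rel_def by blast
    then show "cproj_rel p r"
      unfolding cproj_rel_def by (intro conjI exI[of _ "d * c"]) auto
  qed
qed

quotient_type 'n cproj = "complex ^ ('n :: finite)" / partial: cproj_rel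
  by (rule cproj_rel_part_equivp)

text \<open>The map of projective space induced by a matrix. It is a genuine projective map on points not
  lying in the kernel; points in the kernel are sent to themselves by convention. By the
  lemmas \<open>yang_baxter_map_abs\<close> and \<open>reflection_map_abs\<close> below (with \<open>robin_matrix_nonzero\<close> and
  \<open>mixed_matrix_nonzero\<close>), this convention is never used for admissible parameters.\<close>

lift_definition proj_apply :: "complex ^ 'n ^ 'n \<Rightarrow> 'n cproj \<Rightarrow> 'n cproj"
  is "\<lambda>A p. if A *v p \<noteq> 0 then A *v p else p"
proof -
  fix A :: "complex ^ 'n ^ 'n" and p q :: "complex ^ 'n"
  assume "cproj_rel p q"
  then obtain c where c: "p \<noteq> 0" "q \<noteq> 0" "c \<noteq> 0" "q = c *s p"
    unfolding cproj_rel_def by blast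
  have "A *v q = c *s (A *v p)"
    using c by (simp add: vector_scalar_commute)
  with c show "cproj_rel (if A *v p \<noteq> 0 then A *v p else p) (if A *v q \<noteq> 0 then A *v q else q)"
    unfolding cproj_rel_def by auto
qed

text \<open>\<open>hermitian_sq p\<close> is the scalar \<open>p\<^sup>\<dagger> p\<close>, and \<open>dressing c p\<close> is the matrix \<open>I + c p p\<^sup>\<dagger> / (p\<^sup>\<dagger> p)\<close>;
  it depends only on the point of projective space represented by \<open>p\<close>.\<close>

definition hermitian_sq :: "complex ^ 'n \<Rightarrow> complex" where
  "hermitian_sq p = (\<Sum>i\<in>UNIV. cnj (p $ i) * p $ i)"

definition dressing_vec :: "complex \<Rightarrow> complex ^ 'n \<Rightarrow> complex ^ 'n ^ 'n" where
  "dressing_vec c p = mat 1 + (\<chi> i j. c * (p $ i * cnj (p $ j) / hermitian_sq p))"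

lemma hermitian_sq_scale: "hermitian_sq (c *s p) = (c * cnj c) * hermitian_sq p"
  unfolding hermitian_sq_def by (simp add: sum_distrib_left algebra_simps)

lift_definition dressing :: "complex \<Rightarrow> 'n cproj \<Rightarrow> complex ^ 'n ^ 'n" is dressing_vec
proof -
  fix a :: complex and p q :: "complex ^ 'n"
  assume "cproj_rel p q"
  then obtain c where c: "c \<noteq> 0" and q: "q = c *s p"
    unfolding cproj_rel_def by blast
  have "(c * x) * cnj (c * y) / (c * cnj c * h) = x * cnj y / h" for x y h
    using c by (simp add: field_simps)
  then show "dressing_vec a p = dressing_vec a q"
    unfolding q dressing_vec_def hermitian_sq_scale vector_smult_component by simp
qed

definition yang_baxter_map :: "complex \<Rightarrow> complex \<Rightarrow> ('n :: finite) cproj \<times> 'n cproj \<Rightarrow> 'n cproj \<times> 'n cproj" where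
  "yang_baxter_map k1 k2 = (\<lambda>(P1, P2).
     (proj_apply (dressing ((cnj k1 - k2) / (cnj k1 - cnj k2) - 1) P2) P1,
      proj_apply (dressing ((k2 - cnj k1) / (k2 - k1) - 1) P1) P2))"

abbreviation R12 :: "complex \<Rightarrow> complex \<Rightarrow> ('n :: finite) cproj \<times> 'n cproj \<Rightarrow> 'n cproj \<times> 'n cproj" where
  "R12 \<equiv> yang_baxter_map"

definition R21 :: "complex \<Rightarrow> complex \<Rightarrow> ('n :: finite) cproj \<times> 'n cproj \<Rightarrow> 'n cproj \<times> 'n cproj" where
  "R21 a b = prod.swap \<circ> yang_baxter_map a b \<circ> prod.swap"

definition robin_matrix :: "real \<Rightarrow> complex \<Rightarrow> complex ^ 'n ^ 'n" where
  "robin_matrix \<alpha> k =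
     (let h = (k - \<i> * of_real \<alpha>) / (k + \<i> * of_real \<alpha>) in mat (h / of_real (cmod h)))"

definition mixed_matrix :: "'n set \<Rightarrow> complex \<Rightarrow> complex ^ 'n ^ 'n" where
  "mixed_matrix S k = (\<chi> i j. if i = j then (if i \<in> S then 1 else -1) else 0)"

definition reflection_map ::
    "(complex \<Rightarrow> complex ^ 'n ^ ('n :: finite)) \<Rightarrow> complex \<Rightarrow> 'n cproj \<Rightarrow> 'n cproj" where
  "reflection_map m k P = proj_apply (dressing ((k - cnj k) / (k + cnj k)) P ** m k) P"

definition B1 ::
    "(complex \<Rightarrow> complex ^ 'n ^ ('n :: finite)) \<Rightarrow> complex \<Rightarrow> 'n cproj \<times> 'n cproj \<Rightarrow> 'n cproj \<times> 'n cproj" where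
  "B1 m k = map_prod (reflection_map m k) id"

definition B2 ::
    "(complex \<Rightarrow> complex ^ 'n ^ ('n :: finite)) \<Rightarrow> complex \<Rightarrow> 'n cproj \<times> 'n cproj \<Rightarrow> 'n cproj \<times> 'n cproj" where
  "B2 m k = map_prod id (reflection_map m k)"

lemma cproj_rel_refl: "p \<noteq> 0 \<Longrightarrow> cproj_rel p p"
  unfolding cproj_rel_def by (auto intro!: exI[of _ 1])

lemma proj_apply_abs:
  assumes "p \<noteq> 0" "A *v p \<noteq> 0"
  shows "proj_apply A (abs_cproj p) = abs_cproj (A *v p)"
  using assms proj_apply.abs_eq[of p A] cproj_rel_refl[of p] by simp

lemma dressing_abs: "p \<noteq> 0 \<Longrightarrow> dressing c (abs_cproj p) = dressing_vec c p"
  by (rule dressing.abs_eq) (rule cproj_rel_refl)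

lemma hermitian_sq_eq: "hermitian_sq p = of_real ((norm p)\<^sup>2)"
  unfolding hermitian_sq_def norm_vec_def L2_set_def
  by (simp add: sum_nonneg complex_norm_square mult.commute del: of_real_power)

lemma dressing_vec_mult:
  "dressing_vec c p *v v = v + (c * (\<Sum>j\<in>UNIV. cnj (p $ j) * v $ j) / hermitian_sq p) *s p"
  unfolding dressing_vec_def matrix_vector_mult_add_rdistrib matrix_vector_mul_lid
  by (simp add: vec_eq_iff matrix_vector_mult_def sum_distrib_left sum_divide_distrib
      sum_distrib_right algebra_simps)

lemma dressing_vec_nonzero:
  assumes "p \<noteq> 0" "v \<noteq> 0" "c \<noteq> -1"
  shows "dressing_vec c p *v v \<noteq> 0"
proof
  assume 0: "dressing_vec c p *v v = 0"
  define s where "s = (\<Sum>j\<in>UNIV. cnj (p $ j) * v $ j)"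
  have H: "hermitian_sq p \<noteq> 0" using assms(1) by (simp add: hermitian_sq_eq)
  have v: "v $ i + c * s / hermitian_sq p * p $ i = 0" for i
    using arg_cong[OF 0, of "\<lambda>x. x $ i"] by (simp add: dressing_vec_mult s_def)
  have "0 = (\<Sum>i\<in>UNIV. cnj (p $ i) * (v $ i + c * s / hermitian_sq p * p $ i))"
    by (simp only: v) simp
  also have "\<dots> = s + c * s / hermitian_sq p * hermitian_sq p"
  proof -
    have "(\<Sum>i\<in>UNIV. cnj (p $ i) * (a * p $ i)) = a * hermitian_sq p" for a
      by (simp add: hermitian_sq_def sum_distrib_left mult.left_commute)
    then show ?thesis
      unfolding distrib_left sum.distrib by (simp only: s_def)
  qed
  also have "\<dots> = (1 + c) * s" using H by (simp add: algebra_simps)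
  finally have "s = 0" using assms(3) by (auto simp: add_eq_0_iff)
  with v have "v = 0" by (simp add: vec_eq_iff)
  with assms(2) show False by simp
qed

lemma yang_baxter_map_abs:
  assumes "p1 \<noteq> 0" "p2 \<noteq> 0" "k1 \<noteq> k2" "k1 \<noteq> cnj k2"
  shows "yang_baxter_map k1 k2 (abs_cproj p1, abs_cproj p2) =
    (abs_cproj (dressing_vec ((cnj k1 - k2) / (cnj k1 - cnj k2) - 1) p2 *v p1),
     abs_cproj (dressing_vec ((k2 - cnj k1) / (k2 - k1) - 1) p1 *v p2))"
proof -
  have "cnj k1 \<noteq> k2" using assms(4) by auto
  then have "(cnj k1 - k2) / (cnj k1 - cnj k2) - 1 \<noteq> -1" "(k2 - cnj k1) / (k2 - k1) - 1 \<noteq> -1"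
    using assms(3) by auto
  then show ?thesis
    using assms by (simp add: yang_baxter_map_def dressing_abs proj_apply_abs dressing_vec_nonzero)
qed

lemma robin_matrix_nonzero:
  assumes "Re k \<noteq> 0" "p \<noteq> 0"
  shows "robin_matrix \<alpha> k *v p \<noteq> 0"
proof -
  have "k - \<i> * of_real \<alpha> \<noteq> 0" "k + \<i> * of_real \<alpha> \<noteq> 0"
    using assms(1) by (auto simp: complex_eq_iff)
  moreover have "mat c *v p = c *s p" for c
    by (simp add: vec_eq_iff matrix_vector_mult_def mat_def if_distrib[where f="\<lambda>x. x * _"]
        cong: if_cong)
  ultimately show ?thesis using assms(2) by (simp add: robin_matrix_def Let_def)
qed

lemma mixed_matrix_nonzero:
  assumes "p \<noteq> 0"
  shows "mixed_matrix S k *v p \<noteq> 0"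
proof -
  have "mixed_matrix S k *v p = (\<chi> i. (if i \<in> S then 1 else -1) * p $ i)"
    by (simp add: vec_eq_iff matrix_vector_mult_def mixed_matrix_def if_distrib[where f="\<lambda>x. x * _"]
        cong: if_cong)
  with assms show ?thesis by (auto simp: vec_eq_iff split: if_splits)
qed

lemma reflection_map_abs:
  assumes "p \<noteq> 0" "Re k \<noteq> 0" "m k *v p \<noteq> 0"
  shows "reflection_map m k (abs_cproj p) =
    abs_cproj (dressing_vec ((k - cnj k) / (k + cnj k)) p *v (m k *v p))"
proof -
  have "k + cnj k \<noteq> 0" using assms(2) by (auto simp: complex_eq_iff)
  moreover have "k \<noteq> 0" using assms(2) by auto
  ultimately have "(k - cnj k) / (k + cnj k) \<noteq> -1"
    by (auto simp: divide_eq_eq)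
  then show ?thesis
    using assms by (simp add: reflection_map_def dressing_abs proj_apply_abs dressing_vec_nonzero
        matrix_vector_mul_assoc[symmetric])
qed

end

theory Submission
  imports Defs
begin

text \<open>Both maps are evaluations of Darboux factors. Put
  \<open>E \<kappa> P \<zeta> = I + ((\<zeta> - \<kappa>) / (\<zeta> - \<kappa>\<^sup>*) - 1) \<Pi>\<^sub>P\<close> with \<open>\<Pi>\<^sub>P\<close> the orthogonal projection onto
  the line \<open>P\<close>. The Yang-Baxter map is the refactorization
  \<open>E x A \<zeta> \<cdot> E y B \<zeta> = E y C \<zeta> \<cdot> E x D \<zeta>\<close> with \<open>A = E y B x D\<close> and \<open>C = E x D y B\<close>.
  With \<open>M\<close> the boundary matrix, the reflection \<open>P' = E k P (-k) M P\<close> is the special case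
  \<open>x = k\<close>, \<open>y = -k\<close>, \<open>D = P\<close>, \<open>B = M P\<close>, and it makes \<open>T \<zeta> = E (-k) P' \<zeta> \<cdot> E k P \<zeta>\<close>
  satisfy \<open>T \<zeta> = M \<cdot> T (-\<zeta>) \<cdot> M\<close>. Exchanging factors turns both sides of the reflection
  equation, applied to \<open>(x\<^sub>0, y\<^sub>0)\<close>, into the same explicit pair
  \<open>y\<^sub>3 = E k\<^sub>2 y\<^sub>0 (-k\<^sub>2) \<cdot> E k\<^sub>1 x\<^sub>0 (-k\<^sub>2) \<cdot> M \<cdot> E k\<^sub>1\<^sup>* x\<^sub>0 k\<^sub>2 \<cdot> y\<^sub>0\<close> and
  \<open>x\<^sub>3 = E (-k\<^sub>2) y\<^sub>3 (-k\<^sub>1) \<cdot> E k\<^sub>2 y\<^sub>0 (-k\<^sub>1) \<cdot> E k\<^sub>1 x\<^sub>0 (-k\<^sub>1) \<cdot> M x\<^sub>0\<close>.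
  This uses no kernels, so real \<open>k\<^sub>1\<close>, \<open>k\<^sub>2\<close>, for which a factor is scalar, need no limit argument.
  The Robin matrix is a phase, hence acts projectively as \<open>I\<close>, the mixed matrix of the full index set.\<close>

section \<open>Darboux factors on vectors\<close>

definition hdot :: "complex ^ 'n \<Rightarrow> complex ^ 'n \<Rightarrow> complex" where
  "hdot p v = (\<Sum>i\<in>UNIV. cnj (p $ i) * v $ i)"

lemma hdot_add_right: "hdot p (u + v) = hdot p u + hdot p v"
  and hdot_add_left: "hdot (p + q) v = hdot p v + hdot q v"
  and hdot_diff_right: "hdot p (u - v) = hdot p u - hdot p v"
  and hdot_scale_right: "hdot p (c *s v) = c * hdot p v"
  and hdot_scale_left: "hdot (c *s p) v = cnj c * hdot p v"
  by (simp_all add: hdot_def sum.distrib sum_subtractf sum_distrib_left algebra_simps)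

lemma cnj_hdot: "cnj (hdot p v) = hdot v p"
  by (simp add: hdot_def mult.commute)

lemma hdot_self_eq_0_iff: "hdot p p = 0 \<longleftrightarrow> p = 0"
  using hermitian_sq_eq[of p] by (simp add: hdot_def hermitian_sq_def)

text \<open>\<open>darboux_vec \<kappa> p \<zeta>\<close> is \<open>\<zeta> - \<kappa>\<^sup>*\<close> times the factor \<open>E \<kappa> p \<zeta>\<close>, which clears its pole.\<close>

definition darboux_vec :: "complex \<Rightarrow> complex ^ 'n \<Rightarrow> complex \<Rightarrow> complex ^ 'n \<Rightarrow> complex ^ 'n" where
  "darboux_vec \<kappa> p \<zeta> v = (\<zeta> - cnj \<kappa>) *s v + ((cnj \<kappa> - \<kappa>) * hdot p v / hdot p p) *s p"

lemma darboux_vec_scale_point: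
  assumes "c \<noteq> 0"
  shows "darboux_vec \<kappa> (c *s p) = darboux_vec \<kappa> p"
  by (simp add: assms fun_eq_iff vec_eq_iff darboux_vec_def hdot_scale_left hdot_scale_right)

lemma darboux_vec_scale: "darboux_vec \<kappa> p \<zeta> (c *s v) = c *s darboux_vec \<kappa> p \<zeta> v"
  by (simp add: darboux_vec_def hdot_scale_right vec_eq_iff field_simps)

text \<open>The \<open>d\<close> and \<open>b\<close> components of the exchange relation, with primes for complex conjugates, \<open>D\<close>,
  \<open>B\<close>, \<open>g\<close> the Gram entries of \<open>d\<close>, \<open>b\<close>, and \<open>a\<close>, \<open>c\<close> rescaled by \<open>B\<close>, \<open>D\<close>. The point of the
  rescaling is that the squared norms of \<open>a\<close> and \<open>c\<close> become \<open>B * N\<close> and \<open>D * N\<close> with the same \<open>N\<close>.\<close>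

lemma exchange_coefficient:
  fixes x x' y y' D B g g' u w d b l N :: complex
  assumes "D \<noteq> 0" "B \<noteq> 0" "N \<noteq> 0"
    "N = (x - y') * (x' - y) * (D * B - g * g') + (x - y) * (x' - y') * g * g'"
  defines "a \<equiv> (x - y') * B * d + (y' - y) * g' * b"
  defines "c \<equiv> (y - x') * D * b + (x' - x) * g * d"
  defines "av \<equiv> (x' - y) * B * u + (y - y') * g * w"
  defines "cv \<equiv> (y' - x) * D * w + (x - x') * g' * u"
  shows "(l - x') * ((y' - y) * w / B * b) + (x' - x) * ((l - y') * av + (y' - y) * w * g * (x' - y')) / (B * N) * a
    = (l - y') * ((x' - x) * u / D * d) + (y' - y) * ((l - x') * cv + (x' - x) * u * g' * (y' - x')) / (D * N) * c"
proof -
  have "D * N * (l - x') * (y' - y) * w * b + D * (x' - x) * ((l - y') * av + (y' - y) * w * g * (x' - y')) * a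
    = B * N * (l - y') * (x' - x) * u * d + B * (y' - y) * ((l - x') * cv + (x' - x) * u * g' * (y' - x')) * c"
    unfolding a_def c_def av_def cv_def assms(4) by algebra
  then show ?thesis using assms(1-3) by (simp add: divide_simps) algebra
qed

text \<open>The eigenvalues are \<open>\<zeta> - \<kappa>\<close> on the line of \<open>p\<close>
  and \<open>\<zeta> - cnj \<kappa>\<close> on its orthogonal complement.\<close>

lemma darboux_vec_nonzero:
  assumes "p \<noteq> 0" "v \<noteq> 0" "\<zeta> \<noteq> \<kappa>" "\<zeta> \<noteq> cnj \<kappa>"
  shows "darboux_vec \<kappa> p \<zeta> v \<noteq> 0"
proof
  assume 0: "darboux_vec \<kappa> p \<zeta> v = 0"
  have "hdot p (darboux_vec \<kappa> p \<zeta> v) = (\<zeta> - \<kappa>) * hdot p v"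
    using hdot_self_eq_0_iff[of p] assms(1)
    by (simp add: darboux_vec_def hdot_add_right hdot_diff_right hdot_scale_right field_simps)
  then have "hdot p v = 0" using 0 assms(3) by (simp add: hdot_def)
  with 0 assms show False by (simp add: darboux_vec_def)
qed

lemma darboux_vec_exchange:
  fixes d b :: "complex ^ 'n"
  assumes "d \<noteq> 0" "b \<noteq> 0" "x \<noteq> y" "x \<noteq> cnj y"
  defines "a \<equiv> darboux_vec y b x d" and "c \<equiv> darboux_vec x d y b"
  shows "darboux_vec x a l (darboux_vec y b l v) = darboux_vec y c l (darboux_vec x d l v)"
proof -
  define D B g g' u w where "D = hdot d d" and "B = hdot b b" and "g = hdot d b" and "g' = hdot b d"
    and "u = hdot d v" and "w = hdot b v"
  define x' y' where "x' = cnj x" and "y' = cnj y"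
  define N where "N = (x - y') * (x' - y) * (D * B - g * g') + (x - y) * (x' - y') * g * g'"
  define a' c' where "a' = B *s a" and "c' = D *s c"
  have nz: "D \<noteq> 0" "B \<noteq> 0" using assms by (simp_all add: D_def B_def hdot_self_eq_0_iff)
  have cnjs: "cnj D = D" "cnj B = B" "cnj g = g'" "cnj g' = g" "cnj x = x'" "cnj y = y'" "cnj x' = x" "cnj y' = y"
    by (simp_all add: D_def B_def g_def g'_def cnj_hdot x'_def y'_def)
  have a': "a' = ((x - y') * B) *s d + ((y' - y) * g') *s b"
    using nz by (simp add: a'_def a_def darboux_vec_def vec_eq_iff field_simps flip: B_def g'_def y'_def)
  have c': "c' = ((y - x') * D) *s b + ((x' - x) * g) *s d"
    using nz by (simp add: c'_def c_def darboux_vec_def vec_eq_iff field_simps flip: D_def g_def x'_def)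
  have ha: "hdot a' z = (x' - y) * B * hdot d z + (y - y') * g * hdot b z" for z
    by (simp add: a' hdot_add_left hdot_scale_left cnjs)
  have hc: "hdot c' z = (y' - x) * D * hdot b z + (x - x') * g' * hdot d z" for z
    by (simp add: c' hdot_add_left hdot_scale_left cnjs)
  have haa: "hdot a' a' = B * N"
    unfolding ha by (simp add: a' hdot_add_right hdot_scale_right N_def flip: D_def B_def g_def g'_def) algebra
  have hcc: "hdot c' c' = D * N"
    unfolding hc by (simp add: c' hdot_add_right hdot_scale_right N_def flip: D_def B_def g_def g'_def) algebra
  have "a' \<noteq> 0" using darboux_vec_nonzero[of b d x y] assms nz by (simp add: a'_def)
  then have "N \<noteq> 0" using haa by (auto simp: hdot_self_eq_0_iff)
  have fa: "darboux_vec x a = darboux_vec x a'" and fc: "darboux_vec y c = darboux_vec y c'"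
    by (auto simp: a'_def c'_def darboux_vec_scale_point nz fun_eq_iff)
  have hav: "hdot a' (darboux_vec y b l v) =
      (l - y') * ((x' - y) * B * u + (y - y') * g * w) + (y' - y) * w * g * (x' - y')"
    using nz
    by (simp add: darboux_vec_def hdot_add_right hdot_diff_right hdot_scale_right ha cnjs
        flip: D_def B_def g_def g'_def u_def w_def)
      (simp add: field_simps)
  have hcv: "hdot c' (darboux_vec x d l v) =
      (l - x') * ((y' - x) * D * w + (x - x') * g' * u) + (x' - x) * u * g' * (y' - x')"
    using nz
    by (simp add: darboux_vec_def hdot_add_right hdot_diff_right hdot_scale_right hc cnjs
        flip: D_def B_def g_def g'_def u_def w_def)
      (simp add: field_simps)
  have "darboux_vec x a' l (darboux_vec y b l v) $ i = darboux_vec y c' l (darboux_vec x d l v) $ i" for i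
  proof -
    \<comment> \<open>The part along \<open>v\<close>, here \<open>t\<close>, has the same
      coefficient on both sides; only the parts along \<open>d\<close> and \<open>b\<close>
      remain.\<close>
    have comb: "(l - x') * ((l - y') * t + P) + Q = (l - y') * ((l - x') * t + R) + S"
      if "(l - x') * P + Q = (l - y') * R + S" for t P Q R S
      using that by algebra
    show ?thesis
      unfolding darboux_vec_def[of x a'] darboux_vec_def[of y c'] hav hcv haa hcc
      unfolding darboux_vec_def vector_add_component vector_smult_component a' c' cnjs
        B_def[symmetric] D_def[symmetric] u_def[symmetric] w_def[symmetric]
      by (rule comb, rule exchange_coefficient[OF nz \<open>N \<noteq> 0\<close> N_def])
  qed
  then show ?thesis unfolding fa fc by (simp add: vec_eq_iff)
qed

text \<open>For non-real \<open>x\<close>, evaluate the exchange at \<open>l = cnj x\<close> on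
  \<open>d\<close>: the factor of \<open>d\<close> is the scalar \<open>cnj x - x\<close> there,
  while the factor of \<open>a\<close> has rank one with range the line of \<open>a\<close>.\<close>

lemma darboux_vec_exchange_point:
  assumes "d \<noteq> 0" "b \<noteq> 0" "x \<noteq> y" "x \<noteq> cnj y"
  defines "a \<equiv> darboux_vec y b x d" and "c \<equiv> darboux_vec x d y b"
  shows "\<exists>s. darboux_vec y c (cnj x) d = s *s a"
proof (cases "x = cnj x")
  case True
  \<comment> \<open>The factor \<open>cnj x - x\<close> cancelled in the other case vanishes, but \<open>c\<close> and \<open>b\<close> span the same line.\<close>
  then have "c = (y - x) *s b" by (simp add: c_def darboux_vec_def flip: True)
  then have "darboux_vec y c (cnj x) d = darboux_vec y b x d"
    using assms(3) by (simp add: darboux_vec_scale_point del: vector_sub_rdistrib flip: True)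
  then show ?thesis by (intro exI[of _ 1]) (simp add: a_def)
next
  case False
  have nz: "hdot d d \<noteq> 0" "hdot b b \<noteq> 0" using assms by (simp_all add: hdot_self_eq_0_iff)
  have "(cnj x - x) *s darboux_vec y c (cnj x) d = darboux_vec y c (cnj x) (darboux_vec x d (cnj x) d)"
    using nz by (simp add: darboux_vec_scale[symmetric] darboux_vec_def[of x d])
  also have "\<dots> = darboux_vec x a (cnj x) (darboux_vec y b (cnj x) d)"
    unfolding a_def c_def using darboux_vec_exchange[OF assms(1-4)] by simp
  also have "\<dots> = ((cnj x - x) * hdot a (darboux_vec y b (cnj x) d) / hdot a a) *s a"
    by (simp add: darboux_vec_def[of x])
  also have "\<dots> = (cnj x - x) *s ((hdot a (darboux_vec y b (cnj x) d) / hdot a a) *s a)"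
    by (simp del: vector_sub_rdistrib)
  finally have "darboux_vec y c (cnj x) d = (hdot a (darboux_vec y b (cnj x) d) / hdot a a) *s a"
    using False by (simp only: vector_mul_lcancel) simp
  then show ?thesis by blast
qed

section \<open>Darboux factors on projective space\<close>

lemma cproj_cases: obtains p where "p \<noteq> 0" "P = abs_cproj p"
proof
  show "P = abs_cproj (rep_cproj P)"
    using Quotient_abs_rep[OF Quotient_cproj] by metis
  show "rep_cproj P \<noteq> 0"
    using Quotient_rep_reflp[OF Quotient_cproj, of P] by (simp add: cproj_rel_def)
qed

lemma abs_cproj_scale:
  assumes "c \<noteq> 0" "p \<noteq> 0"
  shows "abs_cproj (c *s p) = abs_cproj p"
proof -
  have "cproj_rel p (c *s p)"
    using assms by (auto simp: cproj_rel_def)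
  then show ?thesis
    using Quotient_rel_abs[OF Quotient_cproj] by metis
qed

definition darboux :: "complex \<Rightarrow> 'n cproj \<Rightarrow> complex \<Rightarrow> 'n cproj \<Rightarrow> ('n::finite) cproj" where
  "darboux \<kappa> P \<zeta> = proj_apply (dressing ((\<zeta> - \<kappa>) / (\<zeta> - cnj \<kappa>) - 1) P)"

lemma darboux_abs:
  assumes "p \<noteq> 0" "v \<noteq> 0" "\<zeta> \<notin> {\<kappa>, cnj \<kappa>}"
  shows "darboux \<kappa> (abs_cproj p) \<zeta> (abs_cproj v) = abs_cproj (darboux_vec \<kappa> p \<zeta> v)"
proof -
  let ?c = "(\<zeta> - \<kappa>) / (\<zeta> - cnj \<kappa>) - 1"
  have "dressing_vec ?c p *v v \<noteq> 0"
    using assms by (intro dressing_vec_nonzero) auto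
  moreover have "darboux_vec \<kappa> p \<zeta> v = (\<zeta> - cnj \<kappa>) *s (dressing_vec ?c p *v v)"
  proof -
    have "cnj \<kappa> - \<kappa> = (\<zeta> - cnj \<kappa>) * ?c"
      using assms(3) by (simp add: field_simps)
    then show ?thesis
      by (simp add: vec_eq_iff darboux_vec_def dressing_vec_mult hermitian_sq_def hdot_def distrib_left
          del: vector_sub_rdistrib)
  qed
  ultimately show ?thesis
    using assms by (simp add: darboux_def dressing_abs proj_apply_abs abs_cproj_scale del: vector_sub_rdistrib)
qed

text \<open>Conjugating the parameter swaps the two eigenvalues, so the product is a scalar.\<close>

lemma darboux_inverse:
  assumes "\<zeta> \<notin> {\<kappa>, cnj \<kappa>}"
  shows "darboux (cnj \<kappa>) P \<zeta> (darboux \<kappa> P \<zeta> Q) = Q"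
proof -
  obtain p where p: "p \<noteq> 0" "P = abs_cproj p" by (rule cproj_cases)
  obtain q where q: "q \<noteq> 0" "Q = abs_cproj q" by (rule cproj_cases)
  have "darboux_vec (cnj \<kappa>) p \<zeta> (darboux_vec \<kappa> p \<zeta> q) = ((\<zeta> - \<kappa>) * (\<zeta> - cnj \<kappa>)) *s q"
    using p(1) by (simp add: vec_eq_iff darboux_vec_def hdot_add_right hdot_diff_right hdot_scale_right
        hdot_self_eq_0_iff field_simps)
  then show ?thesis
    using assms p q by (simp add: darboux_abs darboux_vec_nonzero abs_cproj_scale del: vector_sub_rdistrib)
qed

lemma darboux_inverse':
  assumes "\<zeta> \<notin> {\<kappa>, cnj \<kappa>}"
  shows "darboux \<kappa> P \<zeta> (darboux (cnj \<kappa>) P \<zeta> Q) = Q"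
  using darboux_inverse[of \<zeta> "cnj \<kappa>"] assms by auto

lemma darboux_minus: "darboux (- \<kappa>) P (- \<zeta>) = darboux \<kappa> P \<zeta>"
proof -
  have "(- \<zeta> - - \<kappa>) / (- \<zeta> - cnj (- \<kappa>)) = (\<zeta> - \<kappa>) / (\<zeta> - cnj \<kappa>)"
    using minus_divide_divide[of "\<zeta> - \<kappa>" "\<zeta> - cnj \<kappa>"] by simp
  then show ?thesis by (simp only: darboux_def)
qed

lemma darboux_exchange:
  assumes "x \<notin> {y, cnj y}" "\<zeta> \<notin> {x, cnj x, y, cnj y}"
    and "A = darboux y B x D" "C = darboux x D y B"
  shows "darboux x A \<zeta> (darboux y B \<zeta> Q) = darboux y C \<zeta> (darboux x D \<zeta> Q)"
proof -
  obtain d where d: "d \<noteq> 0" "D = abs_cproj d" by (rule cproj_cases)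
  obtain b where b: "b \<noteq> 0" "B = abs_cproj b" by (rule cproj_cases)
  obtain q where q: "q \<noteq> 0" "Q = abs_cproj q" by (rule cproj_cases)
  have "y \<notin> {x, cnj x}" using assms(1) by auto
  with assms d b q darboux_vec_exchange[of d b x y \<zeta> q] show ?thesis
    by (simp add: darboux_abs darboux_vec_nonzero)
qed

lemma darboux_exchange_cnj:
  assumes "x \<notin> {y, cnj y}" "\<zeta> \<notin> {x, cnj x, y, cnj y}"
    and "A = darboux y B x D" "C = darboux x D y B"
  shows "darboux (cnj x) A \<zeta> (darboux y C \<zeta> Q) = darboux y B \<zeta> (darboux (cnj x) D \<zeta> Q)"
proof -
  have "darboux y C \<zeta> Q = darboux y C \<zeta> (darboux x D \<zeta> (darboux (cnj x) D \<zeta> Q))"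
    using assms(2) by (simp add: darboux_inverse')
  also have "\<dots> = darboux x A \<zeta> (darboux y B \<zeta> (darboux (cnj x) D \<zeta> Q))"
    using darboux_exchange[OF assms] by simp
  finally show ?thesis
    using assms(2) by (simp add: darboux_inverse)
qed

lemma darboux_exchange_point:
  assumes "x \<notin> {y, cnj y}" and "A = darboux y B x D" "C = darboux x D y B"
  shows "darboux y C (cnj x) D = A"
proof -
  obtain d where d: "d \<noteq> 0" "D = abs_cproj d" by (rule cproj_cases)
  obtain b where b: "b \<noteq> 0" "B = abs_cproj b" by (rule cproj_cases)
  have ne: "y \<notin> {x, cnj x}" "cnj x \<notin> {y, cnj y}" using assms(1) by auto
  define a c where "a = darboux_vec y b x d" and "c = darboux_vec x d y b"
  obtain s where s: "darboux_vec y c (cnj x) d = s *s a"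
    using darboux_vec_exchange_point[of d b x y] assms(1) d b unfolding a_def c_def by auto
  have c: "c \<noteq> 0" "C = abs_cproj c" and a: "a \<noteq> 0" "A = abs_cproj a"
    using assms ne d b by (auto simp: a_def c_def darboux_abs darboux_vec_nonzero)
  have "darboux_vec y c (cnj x) d \<noteq> 0" using c d ne by (auto simp: darboux_vec_nonzero)
  then have "s \<noteq> 0" using s by auto
  then show ?thesis
    using c a d ne by (simp add: darboux_abs s abs_cproj_scale)
qed

section \<open>Reflection by a unitary involution\<close>

definition reflect :: "complex ^ 'n ^ 'n \<Rightarrow> complex \<Rightarrow> 'n cproj \<Rightarrow> ('n::finite) cproj" where
  "reflect M k P = darboux k P (- k) (proj_apply M P)"

context
  fixes M :: "complex ^ 'n ^ 'n"
  assumes inv: "M ** M = mat 1" and unitary: "\<And>u v. hdot (M *v u) (M *v v) = hdot u v"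
begin

abbreviation "mu \<equiv> proj_apply M"

lemma mu_abs:
  assumes "p \<noteq> 0"
  shows "M *v p \<noteq> 0" "mu (abs_cproj p) = abs_cproj (M *v p)"
proof -
  show "M *v p \<noteq> 0"
    using assms unitary[of p p] by (metis hdot_self_eq_0_iff)
  with assms show "mu (abs_cproj p) = abs_cproj (M *v p)" by (rule proj_apply_abs)
qed

lemma mu_mu: "mu (mu P) = P"
proof -
  obtain p where "p \<noteq> 0" "P = abs_cproj p" by (rule cproj_cases)
  then show ?thesis by (simp add: mu_abs matrix_vector_mul_assoc inv)
qed

lemma mu_darboux:
  assumes "\<zeta> \<notin> {\<kappa>, cnj \<kappa>}"
  shows "mu (darboux \<kappa> P \<zeta> Q) = darboux \<kappa> (mu P) \<zeta> (mu Q)"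
proof -
  obtain p where p: "p \<noteq> 0" "P = abs_cproj p" by (rule cproj_cases)
  obtain q where q: "q \<noteq> 0" "Q = abs_cproj q" by (rule cproj_cases)
  have "M *v darboux_vec \<kappa> p \<zeta> q = darboux_vec \<kappa> (M *v p) \<zeta> (M *v q)"
    by (simp add: darboux_vec_def unitary matrix_vector_right_distrib vector_scalar_commute del: vector_sub_rdistrib)
  with assms p q show ?thesis by (simp add: darboux_abs darboux_vec_nonzero mu_abs)
qed

text \<open>In the exchange with \<open>x = k\<close>, \<open>y = - k\<close>, \<open>D = P\<close>,
  \<open>B = mu P\<close>, the point \<open>C\<close> is the reflected one; this identifies
  \<open>A\<close> as its image under \<open>mu\<close>.\<close>

lemma reflect_partner:
  assumes "Re k \<noteq> 0"
  shows "mu (reflect M k P) = darboux (- k) (mu P) k P"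
proof -
  have "- k \<notin> {k, cnj k}" using assms by (auto simp: complex_eq_iff)
  then show ?thesis
    using darboux_minus[of k "mu P" "-k"] by (simp add: reflect_def mu_darboux mu_mu)
qed

lemma reflect_symmetric:
  assumes "Re k \<noteq> 0" "\<zeta> \<notin> {k, cnj k, - k, - cnj k}" and "P' = reflect M k P"
  shows "darboux (- k) P' \<zeta> (darboux k P \<zeta> Q) =
    mu (darboux (- k) P' (- \<zeta>) (darboux k P (- \<zeta>) (mu Q)))"
proof -
  have "k \<notin> {- k, cnj (- k)}" using assms(1) by (auto simp: complex_eq_iff)
  moreover have "\<zeta> \<notin> {k, cnj k, - k, cnj (- k)}" using assms(2) by simp
  ultimately have "darboux (- k) P' \<zeta> (darboux k P \<zeta> Q) =
      darboux k (mu P') \<zeta> (darboux (- k) (mu P) \<zeta> Q)"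
    using assms(1,3) reflect_partner[of k P]
    by (intro darboux_exchange[symmetric]) (simp_all add: reflect_def del: insert_iff)
  also have "\<dots> = mu (darboux k P' \<zeta> (darboux (- k) P \<zeta> (mu Q)))"
    using assms(2) by (simp add: mu_darboux mu_mu)
  finally show ?thesis
    using darboux_minus[of k P \<open>- \<zeta>\<close>] darboux_minus[of k P' "\<zeta>"] by simp
qed

text \<open>Cancels one factor on each side of \<open>reflect_symmetric\<close> by its inverse, the
  factor with conjugate parameter.\<close>

lemma reflect_symmetric_cnj:
  assumes "Re k \<noteq> 0" "\<zeta> \<notin> {k, cnj k, - k, - cnj k}" and "P' = reflect M k P"
  shows "darboux (- cnj k) P' (- \<zeta>) (mu (darboux (- k) P' \<zeta> Q)) =
    darboux k P (- \<zeta>) (mu (darboux (cnj k) P \<zeta> Q))"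
proof -
  have "darboux (- k) P' \<zeta> Q = darboux (- k) P' \<zeta> (darboux k P \<zeta> (darboux (cnj k) P \<zeta> Q))"
    using assms(2) by (simp add: darboux_inverse')
  also have "\<dots> = mu (darboux (- k) P' (- \<zeta>) (darboux k P (- \<zeta>) (mu (darboux (cnj k) P \<zeta> Q))))"
    by (rule reflect_symmetric[OF assms])
  finally show ?thesis
    using assms(2) darboux_inverse[of "- \<zeta>" "- k"] by (simp add: mu_mu)
qed

lemma reflect_involution:
  assumes "Re k \<noteq> 0"
  shows "reflect M (- cnj k) (reflect M k P) = P"
proof -
  define P' where "P' = reflect M k P"
  have ne: "k \<notin> {- k, cnj (- k)}" "cnj k \<notin> {- k, cnj (- k)}" using assms by (auto simp: complex_eq_iff)
  have "darboux (- k) P' (cnj k) P = mu P'"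
    using ne assms unfolding P'_def
    by (intro darboux_exchange_point[where B = "mu P"]) (simp_all add: reflect_partner, simp add: reflect_def)
  then have "reflect M (- cnj k) P' = darboux (- cnj k) P' (cnj k) (darboux (- k) P' (cnj k) P)"
    by (simp add: reflect_def)
  also have "\<dots> = P"
    using darboux_inverse[OF ne(2)] by simp
  finally show ?thesis by (simp add: P'_def)
qed

text \<open>\<open>L\<close> and \<open>R\<close> trace \<open>(x0, y0)\<close> map by map through
  the left and right sides of the equation.\<close>

lemma reflection_equation:
  assumes "Re k1 \<noteq> 0" "Re k2 \<noteq> 0" "k1 \<notin> {k2, cnj k2, - k2, - cnj k2}"
  assumes L: "x1 = darboux k2 y0 (cnj k1) x0" "y1 = darboux (cnj k1) x0 k2 y0"
      "y2 = reflect M k2 y1"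
      "x2 = darboux (- k2) y2 k1 x1" "y3 = darboux k1 x1 (- k2) y2"
      "x3 = reflect M k1 x2"
    and R: "u1 = reflect M k1 x0"
      "u2 = darboux k2 y0 (- k1) u1" "v1 = darboux (- k1) u1 k2 y0"
      "v2 = reflect M k2 v1"
      "u3 = darboux (- k2) v2 (- cnj k1) u2" "v3 = darboux (- cnj k1) u2 (- k2) v2"
  shows "x3 = u3" "y3 = v3"
proof -
  have ne: "k1 \<noteq> k2" "k1 \<noteq> cnj k2" "k1 \<noteq> - k2" "k1 \<noteq> - cnj k2" "k2 \<noteq> - k1"
    "k2 \<noteq> - cnj k1" "cnj k2 \<noteq> - k1" "cnj k2 \<noteq> - cnj k1" "cnj k1 \<noteq> k2"
    "cnj k1 \<noteq> - k2"
    "cnj k1 \<noteq> cnj k2" "cnj k1 \<noteq> - cnj k2" "k1 \<noteq> - k1" "k1 \<noteq> - cnj k1" "cnj k1 \<noteq> - k1" "k2 \<noteq> - k2"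
    "k2 \<noteq> - cnj k2" "cnj k2 \<noteq> - k2"
    using assms(1-3) by (auto simp: complex_eq_iff)
  note ne = ne ne[symmetric]
  have "y3 = darboux k1 x1 (- k2) (darboux k2 y1 (- k2) (mu (darboux (cnj k1) x0 k2 y0)))"
    by (simp add: L reflect_def)
  also have "\<dots> = darboux k2 y0 (- k2) (darboux k1 x0 (- k2) (mu (darboux (cnj k1) x0 k2 y0)))"
    using darboux_exchange_cnj[OF _ _ L(1,2), of "- k2"] ne by simp
  \<comment> \<open>The symmetry of the first reflection trades \<open>x0\<close> for
    \<open>u1\<close> on both sides of \<open>mu\<close>.\<close>
  also have "\<dots> = darboux k2 y0 (- k2) (darboux (- cnj k1) u1 (- k2) (mu (darboux (- k1) u1 k2 y0)))"
    using reflect_symmetric_cnj[OF assms(1) _ R(1), of k2] ne by simp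
  also have "\<dots> = darboux (- cnj k1) u2 (- k2) (darboux k2 v1 (- k2) (mu v1))"
    using darboux_exchange_cnj[OF _ _ R(2,3), of "- k2"] ne by (simp flip: R(3))
  also have "\<dots> = v3" by (simp add: R reflect_def)
  finally show y: "y3 = v3" .

  have "mu x2 = mu (darboux (- k2) y2 k1 (darboux k2 y1 k1 x0))"
    using darboux_exchange_point[OF _ L(1,2)] ne by (simp add: L(4))
  \<comment> \<open>With \<open>x1\<close> written through \<open>y1\<close> and \<open>x0\<close>,
    both factors belong to the second reflection, whose symmetry turns \<open>k1\<close> into
    \<open>- k1\<close>.\<close>
  also have "\<dots> = darboux (- k2) y2 (- k1) (darboux k2 y1 (- k1) (mu x0))"
    using reflect_symmetric[OF assms(2) _ L(3), of k1] ne by (simp add: mu_mu)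
  finally have "x3 = darboux k1 x2 (- k1) (darboux (- k2) y2 (- k1) (darboux k2 y1 (- k1) (mu x0)))"
    by (simp add: L(6) reflect_def)
  also have "\<dots> = darboux (- k2) y3 (- k1) (darboux k1 x1 (- k1) (darboux k2 y1 (- k1) (mu x0)))"
    using darboux_exchange[OF _ _ L(4,5), of "- k1"] ne by simp
  also have "darboux k1 x1 (- k1) (darboux k2 y1 (- k1) (mu x0)) = darboux k2 y0 (- k1) u1"
    using darboux_exchange_cnj[OF _ _ L(1,2), of "- k1"] ne by (simp add: R reflect_def)
  also have "\<dots> = u2" by (simp add: R)
  also have "darboux (- k2) y3 (- k1) u2 = u3"
    using darboux_exchange_point[OF _ R(5,6)] ne y by simp
  finally show "x3 = u3" .
qed

end

section \<open>The two boundary matrices\<close>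

lemma mixed_matrix_mult: "mixed_matrix S k *v p = (\<chi> i. (if i \<in> S then 1 else -1) * p $ i)"
  by (simp add: vec_eq_iff matrix_vector_mult_def mixed_matrix_def if_distrib[where f="\<lambda>x. x * _"]
      cong: if_cong)

lemma mixed_matrix_involution: "mixed_matrix S k ** mixed_matrix S k = mat 1"
  by (simp add: matrix_eq mixed_matrix_mult vec_eq_iff flip: matrix_vector_mul_assoc)

lemma mixed_matrix_unitary: "hdot (mixed_matrix S k *v u) (mixed_matrix S k *v v) = hdot u v"
  unfolding hdot_def mixed_matrix_mult by (rule sum.cong) auto

text \<open>The given coefficient is that of the Darboux factor at \<open>\<zeta> = - k\<close>. The
  matrix is constant in its argument, so \<open>0\<close> is a dummy.\<close>

lemma reflection_map_mixed:
  assumes "Re k \<noteq> 0"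
  shows "reflection_map (mixed_matrix S) k = reflect (mixed_matrix S 0) k"
proof
  fix P :: "'a cproj"
  obtain p where p: "p \<noteq> 0" "P = abs_cproj p" by (rule cproj_cases)
  have k: "- k - k = - (2 * k)" "- k - cnj k = - (k + cnj k)" "k + cnj k \<noteq> 0" "k \<noteq> 0" "- k - cnj k \<noteq> 0"
    using assms by (auto simp: complex_eq_iff)
  have c: "(k - cnj k) / (k + cnj k) = (- k - k) / (- k - cnj k) - 1"
  proof -
    have "(k - cnj k) / (k + cnj k) = 2 * k / (k + cnj k) - 1" using k(3) by (simp add: field_simps)
    also have "2 * k / (k + cnj k) = (- k - k) / (- k - cnj k)" unfolding k(1,2) by (simp only: minus_divide_divide)
    finally show ?thesis .
  qed
  have "(k - cnj k) / (k + cnj k) \<noteq> -1" unfolding c using k by simp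
  then have "dressing_vec ((k - cnj k) / (k + cnj k)) p *v (mixed_matrix S k *v p) \<noteq> 0"
    using p by (intro dressing_vec_nonzero mixed_matrix_nonzero)
  moreover have "reflect (mixed_matrix S 0) k P =
      proj_apply (dressing ((k - cnj k) / (k + cnj k)) P) (proj_apply (mixed_matrix S k) P)"
    by (simp only: reflect_def darboux_def c mixed_matrix_def)
  ultimately show "reflection_map (mixed_matrix S) k P = reflect (mixed_matrix S 0) k P"
    using p assms mixed_matrix_nonzero[of p S]
    by (simp add: reflection_map_abs proj_apply_abs dressing_abs)
qed

lemma reflection_map_robin:
  assumes "Re k \<noteq> 0"
  shows "reflection_map (robin_matrix \<alpha>) k = reflection_map (mixed_matrix UNIV) k"
proof
  fix P :: "'a cproj"
  obtain p where p: "p \<noteq> 0" "P = abs_cproj p" by (rule cproj_cases)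
  obtain c where c: "robin_matrix \<alpha> k = (mat c :: complex ^ 'a ^ 'a)" by (simp add: robin_matrix_def Let_def)
  have mat: "mat c *v p = c *s p"
    by (simp add: vec_eq_iff matrix_vector_mult_def mat_def if_distrib[where f="\<lambda>x. x * _"] cong: if_cong)
  have nz: "robin_matrix \<alpha> k *v p \<noteq> 0" "mixed_matrix UNIV k *v p \<noteq> 0"
    using robin_matrix_nonzero[OF assms p(1)] mixed_matrix_nonzero[OF p(1)] by auto
  then have "c \<noteq> 0" using c mat by auto
  let ?A = "dressing_vec ((k - cnj k) / (k + cnj k)) p"
  have k: "k + cnj k \<noteq> 0" "k \<noteq> 0"
    using assms by (auto simp: complex_eq_iff)
  then have "?A *v p \<noteq> 0"
    using p by (intro dressing_vec_nonzero) (auto simp: divide_eq_eq)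
  moreover have "robin_matrix \<alpha> k *v p = c *s p" "mixed_matrix UNIV k *v p = p"
    by (simp_all add: c mat mixed_matrix_mult)
  ultimately show "reflection_map (robin_matrix \<alpha>) k P = reflection_map (mixed_matrix UNIV) k P"
    using p assms nz \<open>c \<noteq> 0\<close>
    by (simp add: reflection_map_abs vector_scalar_commute abs_cproj_scale)
qed

section \<open>Yang-Baxter maps as exchanges with parameters \<open>cnj k1\<close> and
  \<open>k2\<close>, and the conclusion\<close>

lemma R12_darboux:
  "R12 k1 k2 (x, y) = (darboux k2 y (cnj k1) x, darboux (cnj k1) x k2 y)"
  by (simp add: yang_baxter_map_def darboux_def)

lemma R21_darboux:
  "R21 a b (x, y) = (darboux (cnj a) y b x, darboux b x (cnj a) y)"
  by (simp add: R21_def R12_darboux)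

theorem theorem3p3:
  fixes m :: "complex \<Rightarrow> complex ^ 'n ^ 'n"
  assumes "(\<exists>\<alpha>::real. m = robin_matrix \<alpha>) \<or> (\<exists>S::'n set. m = mixed_matrix S)"
  shows "(\<forall>k1 k2. Re k1 \<noteq> 0 \<longrightarrow> Re k2 \<noteq> 0 \<longrightarrow> k1 \<notin> {k2, cnj k2, - k2, - cnj k2} \<longrightarrow>
           B1 m k1 \<circ> R21 (- cnj k2) k1 \<circ> B2 m k2 \<circ> R12 k1 k2 =
           R21 (- cnj k2) (- cnj k1) \<circ> B2 m k2 \<circ> R12 (- cnj k1) k2 \<circ> B1 m k1) \<and>
         (\<forall>k. Re k \<noteq> 0 \<longrightarrow> reflection_map m (- cnj k) \<circ> reflection_map m k = id)"
proof -
  obtain S :: "'n set" where m: "reflection_map m k = reflect (mixed_matrix S 0) k" if "Re k \<noteq> 0" for k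
    using assms reflection_map_mixed reflection_map_robin by metis
  note refl = reflection_equation[OF mixed_matrix_involution mixed_matrix_unitary]
    reflect_involution[OF mixed_matrix_involution mixed_matrix_unitary]
  show ?thesis
    by (auto simp: fun_eq_iff m B1_def B2_def R12_darboux R21_darboux refl(3)
        intro!: refl(1,2)[OF _ _ _ HOL.refl HOL.refl HOL.refl HOL.refl HOL.refl HOL.refl
          HOL.refl HOL.refl HOL.refl HOL.refl HOL.refl HOL.refl])
qed

end
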